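(* For every $\varepsilon > 0$ there is a constant $C_\varepsilon > 0$ such that for all positive integers $n$, $$P(n) \le C_\varepsilon\, n^{\frac{1}{3}-\frac{2}{177}+\varepsilon}.$$
   Context: For positive integers $a, n$, define a sequence by $a_0 := a$ and, for $j \ge 0$ (as long as $a_j > 0$), $a_{j+1} := n \pmod{a_j} \in \{0,1,\dots,a_j-1\}$, i.e. $a_{j+1}$ is the remainder of $n$ upon division by $a_j$. Define $P(a,n)$ to be the first positive integer $k$ such that $a_k = 0$, and set $P(n) := \max_{1 \le a \le n} P(a,n)$. *)

theory Defs
  imports Complex_Main
begin

text \<open>
  The sequence is only meaningful up to its first zero: since \<open>n mod 0 = n\<close> in HOL, the
  recursion goes on afterwards with irrelevant values, which \<open>pierce_length\<close> never looks at.
\<close>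

primrec pierce_seq :: "nat \<Rightarrow> nat \<Rightarrow> nat \<Rightarrow> nat" where
  "pierce_seq a n 0 = a"
| "pierce_seq a n (Suc j) = n mod pierce_seq a n j"

definition pierce_length :: "nat \<Rightarrow> nat \<Rightarrow> nat" where
  "pierce_length a n = (LEAST k. 0 < k \<and> pierce_seq a n k = 0)"

definition pierce_max :: "nat \<Rightarrow> nat" where
  "pierce_max n = Max ((\<lambda>a. pierce_length a n) ` {1..n})"

text \<open>
  The sequence does reach zero, so the \<open>LEAST\<close> above is taken over a nonempty set.
\<close>

lemma pierce_seq_reaches_zero:
  assumes "0 < a"
  shows "\<exists>k>0. pierce_seq a n k = 0"
proof (rule ccontr)
  assume "\<not> ?thesis"
  then have pos: "0 < pierce_seq a n k" for k
    using assms by (cases k) auto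
  have "pierce_seq a n k + k \<le> a" for k
  proof (induction k)
    case (Suc k)
    have "pierce_seq a n (Suc k) < pierce_seq a n k"
      using pos[of k] by simp
    with Suc show ?case by linarith
  qed simp
  from this[of "Suc a"] show False by linarith
qed

end

theory Submission
  imports Defs "HOL-Computational_Algebra.Primes"
begin

text \<open>
  Let \<open>b\<^sub>j\<close> be the quotient of \<open>n\<close> by \<open>a\<^sub>j\<close>, so that \<open>n = a\<^sub>j b\<^sub>j + a\<^sub>j\<^sub>+\<^sub>1\<close>. The \<open>a\<^sub>j\<close> decrease strictly and
  the \<open>b\<^sub>j\<close> increase strictly. Write \<open>z = n\<close> to the power \<open>1/59\<close>; as \<open>1/3 - 2/177 = 19/59\<close>, the claim is
  that there are at most about \<open>z\<^sup>1\<^sup>9\<close> terms. They are counted in three ranges of \<open>b\<^sub>j\<close>.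

  \<^item> At most \<open>z\<^sup>1\<^sup>9 + 1\<close> terms have \<open>b\<^sub>j \<le> z\<^sup>1\<^sup>9\<close>, since the \<open>b\<^sub>j\<close> are distinct.

  \<^item> The terms with \<open>b\<^sub>j > z\<^sup>2\<^sup>1\<close> satisfy \<open>a\<^sub>j \<le> z\<^sup>3\<^sup>8\<close>. Here the classical argument of Erdos and Shallit
    applies (\<open>card_small_terms\<close>): with \<open>d = a\<^sub>j - a\<^sub>j\<^sub>+\<^sub>1\<close> one has \<open>n + d = a\<^sub>j (b\<^sub>j + 1)\<close>, so a gap of size \<open>d\<close>
    occurs at most as often as \<open>n + d\<close> has divisors, which is at most \<open>n\<close> to the power \<open>\<epsilon>\<close> up to a
    constant; hence few gaps are below \<open>z\<^sup>1\<^sup>9\<close>, and at most about \<open>z\<^sup>3\<^sup>8 / z\<^sup>1\<^sup>9\<close> gaps are above it.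

  \<^item> The middle range is the heart of the matter. If it had many terms, then most consecutive
    gaps \<open>k, k', k''\<close> of the \<open>b\<^sub>j\<close> would be at most a small power \<open>K\<close> of \<open>z\<close>. The points
    \<open>(b\<^sub>j, a\<^sub>j)\<close> lie close to the hyperbola \<open>x y = n\<close>, and three consecutive ones span a triangle whose
    doubled area is an integer \<open>M\<close>. Expanding all terms in powers of \<open>1/q\<close> with \<open>q = b\<^sub>j\<^sub>+\<^sub>1\<close>, the terms of
    order \<open>n/q\<close> and \<open>n/q\<^sup>2\<close> cancel and \<open>M = Q n/q\<^sup>3 + O(K\<^sup>4 n/q\<^sup>4)\<close>, where
    \<open>Q = k\<^sup>2 k' + (k - 1) k'\<^sup>2 + k k''\<close>. What makes this useful is that \<open>Q\<close> is a positive integer for all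
    positive gaps. So \<open>n/q\<^sup>3\<close> is extremely close to a rational \<open>M/Q\<close> of small height: there are
    few pairs \<open>(Q, M)\<close>, and each of them confines \<open>q\<close> to an interval of length \<open>O(K\<^sup>4)\<close>. With
    \<open>q \<ge> X\<close> there are \<open>O(K\<^sup>3)\<close> choices of \<open>Q\<close> and \<open>O(K\<^sup>3 n/X\<^sup>3)\<close> of \<open>M\<close>, so at most
    \<open>O(K\<^sup>1\<^sup>0 n/X\<^sup>3)\<close> terms have small gaps (\<open>card_short_window\<close>).

  The middle range is cut at \<open>z\<^sup>2\<^sup>0\<close>: gap bounds \<open>K\<close> of about \<open>z\<close> on the first part and \<open>z\<^sup>2\<close> on the
  second leave \<open>O(z\<^sup>1\<^sup>9)\<close> terms with a larger gap in either part (\<open>card_long_window\<close>), and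
  \<open>O(z\<^sup>1\<^sup>2)\<close> resp. \<open>O(z\<^sup>1\<^sup>9)\<close> with small gaps.
\<close>

section \<open>Expansion of the triangle area\<close>

lemma abs_mult_bound:
  fixes x y a b :: real
  assumes "\<bar>x\<bar> \<le> a" "\<bar>y\<bar> \<le> b"
  shows "\<bar>x * y\<bar> \<le> a * b"
  using mult_mono[OF assms] assms by (simp add: abs_mult)

text \<open>
  The formal core of the expansion. With \<open>t = 1/q\<close> and \<open>y\<^sub>i = a\<^sub>j\<^sub>+\<^sub>i q/n\<close>, the equations
  \<open>n = a\<^sub>j\<^sub>+\<^sub>i b\<^sub>j\<^sub>+\<^sub>i + a\<^sub>j\<^sub>+\<^sub>i\<^sub>+\<^sub>1\<close> become the five equations below. The equation for \<open>y4\<close> determines it up to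
  \<open>O(t)\<close> from the mere boundedness of \<open>y5\<close>, and each earlier equation gains one more power of \<open>t\<close>;
  this is why the three gaps \<open>k', k'', k3\<close> after \<open>q\<close> enter the approximation of \<open>y2\<close> up to \<open>O(t\<^sup>3)\<close>.
\<close>

lemma curvature_estimate:
  fixes y0 y1 y2 y3 y4 y5 t K k k' k'' k3 :: real
  assumes t: "0 < t" and K: "1 \<le> K"
    and k: "0 \<le> k" "k \<le> K" and k': "0 \<le> k'" and k'': "0 \<le> k''" and k3: "0 \<le> k3"
    and sum: "k' + k'' + k3 \<le> K"
    and y: "\<bar>y0\<bar> \<le> 2" "\<bar>y1\<bar> \<le> 1" "\<bar>y2\<bar> \<le> 1" "\<bar>y3\<bar> \<le> 1" "\<bar>y4\<bar> \<le> 1" "\<bar>y5\<bar> \<le> 1"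
        "0 \<le> y0" "0 \<le> y1"
    and s0: "y0 * (1 - k * t) + t * y1 = 1"
    and s1: "y1 + t * y2 = 1"
    and s2: "y2 * (1 + k' * t) + t * y3 = 1"
    and s3: "y3 * (1 + (k' + k'') * t) + t * y4 = 1"
    and s4: "y4 * (1 + (k' + k'' + k3) * t) + t * y5 = 1"
  shows "\<bar>k' * (y0 - y1) - k * (y1 - y2) - (k\<^sup>2 * k' + (k - 1) * k'\<^sup>2 + k * k'') * t\<^sup>2\<bar> \<le> 21 * K^4 * t^3"
proof -
  have Kp: "K \<le> K\<^sup>2" "K\<^sup>2 \<le> K^3" "1 \<le> K\<^sup>2" "K \<le> K^3" "K^3 \<le> K^4" "K\<^sup>2 \<le> K^4"
    using K by (auto intro: self_le_power power_increasing)
  have cube: "K * (c * K\<^sup>2) = c * K^3" for c :: real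
    by (simp add: power2_eq_square power3_eq_cube)
  \<comment> \<open>The names \<open>w\<close>, \<open>v\<close> and \<open>u\<close> stand for the exact remainders of first, second and third order.\<close>
  define w4 where "w4 = (k' + k'' + k3) * y4 + y5"
  define w3 where "w3 = (k' + k'') * y3 + y4"
  define v3 where "v3 = (k' + k'') * w3 + w4"
  define w2 where "w2 = k' * y2 + y3"
  define v2 where "v2 = k' * w2 + w3"
  define u2 where "u2 = k' * v2 + v3"
  define w0 where "w0 = k * y0 - y1"
  define v0 where "v0 = k * w0 + y2"
  define u0 where "u0 = k * v0 - w2"
  have e4: "y4 = 1 - t * w4" using s4 by (simp add: w4_def algebra_simps)
  have e3: "y3 = 1 - t * w3" using s3 by (simp add: w3_def algebra_simps)
  have e2: "y2 = 1 - t * w2" using s2 by (simp add: w2_def algebra_simps)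
  have e0: "y0 = 1 + t * w0" using s0 by (simp add: w0_def algebra_simps)
  have f3: "w3 = k' + k'' + 1 - t * v3"
    by (subst w3_def, subst e3, subst e4) (simp add: v3_def algebra_simps)
  have f2: "w2 = k' + 1 - t * v2"
    by (subst w2_def, subst e2, subst e3) (simp add: v2_def algebra_simps)
  have g2: "v2 = k'\<^sup>2 + 2 * k' + k'' + 1 - t * u2"
    by (subst v2_def, subst f2, subst f3) (simp add: u2_def algebra_simps power2_eq_square)
  have e1: "y1 = 1 - t * y2" using s1 by simp
  have f0: "w0 = k - 1 + t * v0"
    by (subst w0_def, subst e0, subst e1) (simp add: v0_def algebra_simps)
  have g0: "v0 = k\<^sup>2 - k + 1 + t * u0"
    by (subst v0_def, subst f0, subst e2) (simp add: u0_def algebra_simps power2_eq_square)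
  have bk': "\<bar>k'\<bar> \<le> K" and bk: "\<bar>k\<bar> \<le> K" and b2: "\<bar>k' + k''\<bar> \<le> K" and b3: "\<bar>k' + k'' + k3\<bar> \<le> K"
    using k k' k'' k3 sum by auto
  have "\<bar>w4\<bar> \<le> 2 * K"
    using abs_mult_bound[OF b3 y(5)] y K unfolding w4_def by linarith
  moreover have w3: "\<bar>w3\<bar> \<le> 2 * K"
    using abs_mult_bound[OF b2 y(4)] y K unfolding w3_def by linarith
  ultimately have v3: "\<bar>v3\<bar> \<le> 4 * K\<^sup>2"
    using abs_mult_bound[OF b2 w3] K Kp unfolding v3_def power2_eq_square by linarith
  have w2: "\<bar>w2\<bar> \<le> 2 * K"
    using abs_mult_bound[OF bk' y(3)] y K unfolding w2_def by linarith
  have v2: "\<bar>v2\<bar> \<le> 4 * K\<^sup>2"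
    using abs_mult_bound[OF bk' w2] w3 K Kp unfolding v2_def power2_eq_square by linarith
  have u2: "\<bar>u2\<bar> \<le> 8 * K^3"
    using abs_mult_bound[OF bk' v2] v3 Kp cube[of 4] unfolding u2_def by linarith
  have "\<bar>k * y0\<bar> \<le> K * 2" "0 \<le> k * y0" using abs_mult_bound[OF bk y(1)] k y by auto
  hence w0: "\<bar>w0\<bar> \<le> 2 * K"
    using y K unfolding w0_def by linarith
  have v0: "\<bar>v0\<bar> \<le> 3 * K\<^sup>2"
    using abs_mult_bound[OF bk w0] y K Kp unfolding v0_def power2_eq_square by linarith
  have u0: "\<bar>u0\<bar> \<le> 5 * K^3"
    using abs_mult_bound[OF bk v0] w2 Kp cube[of 3] unfolding u0_def by linarith
  have "k' * (y0 - y1) - k * (y1 - y2) = t\<^sup>2 * (k' * (v0 - w2) - k * (w2 - v2))"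
    unfolding e1 e2 e0 by (simp add: f0 f2 algebra_simps power2_eq_square)
  also have "\<dots> = t\<^sup>2 * (k' * (k\<^sup>2 - k + 1 + t * u0 - (k' + 1 - t * v2))
      - k * (k' + 1 - t * v2 - (k'\<^sup>2 + 2 * k' + k'' + 1 - t * u2)))"
    by (metis g0 g2 f2)
  also have "\<dots> = (k\<^sup>2 * k' + (k - 1) * k'\<^sup>2 + k * k'') * t\<^sup>2
      + t^3 * (k' * (u0 + v2) + k * (v2 - u2))"
    by (simp add: algebra_simps power2_eq_square power3_eq_cube)
  finally have eq: "k' * (y0 - y1) - k * (y1 - y2) - (k\<^sup>2 * k' + (k - 1) * k'\<^sup>2 + k * k'') * t\<^sup>2
      = t^3 * (k' * (u0 + v2) + k * (v2 - u2))" by simp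
  have "\<bar>u0 + v2\<bar> \<le> 9 * K^3" "\<bar>v2 - u2\<bar> \<le> 12 * K^3"
    using u0 v2 u2 Kp by linarith+
  hence "\<bar>k' * (u0 + v2) + k * (v2 - u2)\<bar> \<le> 21 * K^4"
    using abs_mult_bound[OF bk', of "u0 + v2"] abs_mult_bound[OF bk, of "v2 - u2"]
    by (fastforce simp: power4_eq_xxxx power3_eq_cube)
  thus ?thesis
    unfolding eq using t by (simp add: abs_mult mult.commute)
qed

section \<open>The divisor bound\<close>

lemma card_divisors_prime_power_mult:
  fixes p m :: nat
  assumes "prime p" "0 < m"
  shows "card {d. d dvd p ^ e * m} \<le> Suc e * card {d. d dvd m}"
proof -
  have "{d. d dvd p ^ e * m} \<subseteq> (\<lambda>(i, d). p ^ i * d) ` ({..e} \<times> {d. d dvd m})"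
  proof
    fix d assume "d \<in> {d. d dvd p ^ e * m}"
    then obtain u v where uv: "d = u * v" "u dvd p ^ e" "v dvd m"
      using division_decomp by blast
    then obtain i where "i \<le> e" "u = p ^ i"
      using divides_primepow_nat[OF assms(1)] by blast
    with uv show "d \<in> (\<lambda>(i, d). p ^ i * d) ` ({..e} \<times> {d. d dvd m})" by auto
  qed
  then have "card {d. d dvd p ^ e * m} \<le> card ({..e} \<times> {d. d dvd m})"
    using assms(2) by (intro surj_card_le) auto
  then show ?thesis by (simp add: card_cartesian_product)
qed

text \<open>
  A prime power \<open>p\<^sup>e\<close> contributes \<open>e + 1\<close> to the number of divisors. This is at most \<open>2\<^sup>e\<close>, hence at most
  \<open>p\<close> to the power \<open>\<epsilon> e\<close>, once \<open>p\<close> to the power \<open>\<epsilon>\<close> is at least \<open>2\<close>; each of the boundedly many smaller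
  primes costs only a constant factor \<open>c\<close>.
\<close>

lemma divisor_bound:
  fixes \<epsilon> :: real
  assumes eps: "0 < \<epsilon>"
  shows "\<exists>C>0. \<forall>m::nat. 0 < m \<longrightarrow> real (card {d. d dvd m}) \<le> C * real m powr \<epsilon>"
proof -
  define c where "c = 1 + 1 / (\<epsilon> * ln 2)"
  define P where "P = nat \<lceil>2 powr (1 / \<epsilon>)\<rceil>"
  have c1: "1 \<le> c" using eps by (simp add: c_def)
  have small: "real (Suc e) \<le> c * (real p ^ e) powr \<epsilon>" if "2 \<le> p" for p e :: nat
  proof -
    define x where "x = real e * \<epsilon> * ln 2"
    have x0: "0 \<le> x" using eps by (simp add: x_def)
    have "real (Suc e) = 1 + x / (\<epsilon> * ln 2)" using eps by (simp add: x_def)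
    also have "\<dots> \<le> c * (1 + x)" using eps x0 by (simp add: c_def field_simps)
    also have "\<dots> \<le> c * exp x" using c1 exp_ge_add_one_self[of x] by simp
    also have "exp x = (2 ^ e) powr \<epsilon>" by (simp add: x_def powr_def ln_realpow mult_ac)
    also have "c * (2 ^ e) powr \<epsilon> \<le> c * (real p ^ e) powr \<epsilon>"
      using that eps c1 by (intro mult_left_mono powr_mono2 power_mono) auto
    finally show ?thesis .
  qed
  have large: "real (Suc e) \<le> (real p ^ e) powr \<epsilon>" if "P \<le> p" for p e :: nat
  proof -
    have "2 powr (1 / \<epsilon>) \<le> real p" using that unfolding P_def by linarith
    then have "(2 powr (1 / \<epsilon>)) powr \<epsilon> \<le> real p powr \<epsilon>"
      using eps by (intro powr_mono2) auto
    then have p2: "2 \<le> real p powr \<epsilon>" using eps by (simp add: powr_powr)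
    then have "0 < p" by (cases p) auto
    have "real (Suc e) \<le> 2 ^ e"
      using less_exp[of e] by (metis Suc_leI of_nat_le_iff of_nat_numeral of_nat_power)
    also have "\<dots> \<le> (real p powr \<epsilon>) ^ e" using p2 by (intro power_mono) auto
    also have "\<dots> = (real p ^ e) powr \<epsilon>"
      using \<open>0 < p\<close> by (simp add: powr_realpow[symmetric] powr_powr mult_ac)
    finally show ?thesis .
  qed
  have main: "real (card {d. d dvd m}) \<le> c ^ card {p \<in> prime_factors m. p < P} * real m powr \<epsilon>"
    if "0 < m" for m :: nat
    using that
  proof (induction m rule: less_induct)
    case (less m)
    show ?case
    proof (cases "m = 1")
      case True then show ?thesis by simp
    next
      case False
      then obtain p where p: "prime p" "p dvd m" using prime_factor_nat by blast
      define e where "e = multiplicity p m"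
      obtain m' where m': "m = p ^ e * m'" "\<not> p dvd m'"
        using multiplicity_decompose'[of m p] p less.prems unfolding e_def
        by (metis not_prime_unit not_gr_zero)
      have "0 < e" using p less.prems by (simp add: e_def prime_multiplicity_gt_zero_iff)
      have m'0: "0 < m'" using m' by (cases m') auto
      have "1 < p ^ e" using \<open>0 < e\<close> p by (intro one_less_power) (auto dest: prime_gt_1_nat)
      then have "m' < m" using m' m'0 by simp
      let ?S = "\<lambda>m. {p \<in> prime_factors m. p < P}"
      have IH: "real (card {d. d dvd m'}) \<le> c ^ card (?S m') * real m' powr \<epsilon>"
        using less.IH[OF \<open>m' < m\<close> m'0] .
      have pf: "prime_factors m = insert p (prime_factors m')"
        using m'(1) m'0 p \<open>0 < e\<close> less.prems
        by (auto simp: in_prime_factors_iff prime_dvd_mult_iff prime_dvd_power_iff primes_dvd_imp_eq)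
      have pn: "p \<notin> prime_factors m'" using m' by auto
      define f where "f = (if p < P then c else 1)"
      have cs: "c ^ card (?S m) = f * c ^ card (?S m')"
      proof (cases "p < P")
        case True
        then have "?S m = insert p (?S m')" using pf by auto
        then show ?thesis using True pn by (simp add: f_def)
      next
        case False
        then have "?S m = ?S m'" using pf by auto
        then show ?thesis using False by (simp add: f_def)
      qed
      have "real (Suc e) \<le> f * (real p ^ e) powr \<epsilon>"
        using small[of p e] large[of p e] p prime_ge_2_nat[of p] by (auto simp: f_def)
      moreover have "real (card {d. d dvd m}) \<le> real (Suc e) * real (card {d. d dvd m'})"
        using card_divisors_prime_power_mult[OF p(1) m'0, of e]
        unfolding m'(1) of_nat_mult[symmetric] of_nat_le_iff .
      ultimately have "real (card {d. d dvd m})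
          \<le> (f * (real p ^ e) powr \<epsilon>) * (c ^ card (?S m') * real m' powr \<epsilon>)"
        using IH by (smt (verit) mult_mono of_nat_0_le_iff)
      also have "\<dots> = c ^ card (?S m) * real m powr \<epsilon>"
        unfolding cs by (simp add: m'(1) powr_mult)
      finally show ?thesis .
    qed
  qed
  have "real (card {d. d dvd m}) \<le> c ^ P * real m powr \<epsilon>" if "0 < m" for m :: nat
  proof -
    have "card {p \<in> prime_factors m. p < P} \<le> card {..<P}" by (intro card_mono) auto
    then have "c ^ card {p \<in> prime_factors m. p < P} \<le> c ^ P"
      using c1 by (intro power_increasing) auto
    then show ?thesis using main[OF that] by (smt (verit) mult_right_mono powr_ge_zero)
  qed
  then show ?thesis using c1 by (intro exI[of _ "c ^ P"]) auto
qed

section \<open>Two counting principles\<close>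

lemma card_le_of_diameter:
  fixes A :: "nat set"
  assumes "\<And>x y. x \<in> A \<Longrightarrow> y \<in> A \<Longrightarrow> x \<le> y \<Longrightarrow> y \<le> x + W"
  shows "card A \<le> W + 1"
proof (cases "A = {}")
  case False
  define m where "m = (LEAST x. x \<in> A)"
  have "m \<in> A" using False LeastI_ex[of "\<lambda>x. x \<in> A"] unfolding m_def by auto
  moreover have "m \<le> x" if "x \<in> A" for x
    using that unfolding m_def by (rule Least_le[of "\<lambda>x. x \<in> A"])
  ultimately have "A \<subseteq> {m..m + W}" using assms by fastforce
  from card_mono[OF _ this] show ?thesis by simp
qed simp

lemma card_le_of_fibres:
  assumes "finite R" "\<And>x. x \<in> A \<Longrightarrow> f x \<in> R"
    and "\<And>r. r \<in> R \<Longrightarrow> card {x \<in> A. f x = r} \<le> W"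
  shows "card A \<le> card R * W"
proof -
  have "A = (\<Union>r\<in>R. {x \<in> A. f x = r})" using assms(2) by auto
  then have "card A \<le> (\<Sum>r\<in>R. card {x \<in> A. f x = r})"
    using card_UN_le[OF assms(1)] by metis
  also have "\<dots> \<le> card R * W"
    using sum_bounded_above[of R "\<lambda>r. card {x \<in> A. f x = r}" W] assms(3) by simp
  finally show ?thesis .
qed

section \<open>Pierce expansions\<close>

text \<open>
  In the application \<open>L\<close> is the index of the first zero of \<open>a\<close>, and \<open>b\<close> is the sequence of quotients.
\<close>

locale pierce_expansion =
  fixes n L :: nat and a b :: "nat \<Rightarrow> nat"
  assumes a_pos: "j < L \<Longrightarrow> 0 < a j"
    and n_eq: "j < L \<Longrightarrow> n = a j * b j + a (Suc j)"
    and a_decreasing: "j < L \<Longrightarrow> a (Suc j) < a j"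
begin

lemma n_pos: "Suc j < L \<Longrightarrow> 0 < n"
  using n_eq[of j] a_pos[of "Suc j"] by simp

lemma b_Suc_less:
  assumes "Suc j < L"
  shows "b j < b (Suc j)"
proof (rule ccontr)
  assume "\<not> b j < b (Suc j)"
  then have "a (Suc j) * b (Suc j) \<le> a (Suc j) * b j" by simp
  also have "\<dots> + b j \<le> a j * b j"
    using mult_le_mono1[of "Suc (a (Suc j))" "a j" "b j"] a_decreasing[of j] assms by simp
  finally have "a (Suc j) * b (Suc j) + b j \<le> a j * b j" by simp
  moreover have "a j * b j + a (Suc j) = a (Suc j) * b (Suc j) + a (Suc (Suc j))"
    using n_eq[of j] n_eq[of "Suc j"] assms by simp
  moreover have "a (Suc (Suc j)) < a (Suc j)" using a_decreasing assms by simp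
  ultimately show False by linarith
qed

lemma b_strict_mono: "i < j \<Longrightarrow> j < L \<Longrightarrow> b i < b j"
proof (induction j)
  case (Suc j)
  then show ?case using b_Suc_less[of j] by (cases "i = j") auto
qed simp

lemma a_antimono: "i \<le> j \<Longrightarrow> j \<le> L \<Longrightarrow> a j \<le> a i"
proof (induction j)
  case (Suc j)
  then show ?case using a_decreasing[of j] by (cases "i = Suc j") auto
qed simp

lemma b_inj: "inj_on b {..<L}"
  by (rule inj_onI) (metis b_strict_mono lessThan_iff nat_neq_iff)

lemma a_strict_antimono: "i < j \<Longrightarrow> j \<le> L \<Longrightarrow> a j < a i"
  using a_antimono[of "Suc i" j] a_decreasing[of i] by simp

subsection \<open>Terms followed by small gaps\<close>

text \<open>
  This is the coefficient of \<open>n/q\<^sup>3\<close> in the expansion of \<open>gap_det\<close> at \<open>q = b\<^sub>j\<^sub>+\<^sub>1\<close>.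
\<close>

definition gap_form :: "nat \<Rightarrow> int" where
  "gap_form j = (let k = int (b (j+1)) - int (b j); k' = int (b (j+2)) - int (b (j+1));
              k'' = int (b (j+3)) - int (b (j+2))
          in k\<^sup>2 * k' + (k - 1) * k'\<^sup>2 + k * k'')"

text \<open>
  Twice the signed area of the triangle with corners \<open>(b\<^sub>i, a\<^sub>i)\<close> for \<open>i = j, j+1, j+2\<close>.
\<close>

definition gap_det :: "nat \<Rightarrow> int" where
  "gap_det j = (int (b (j+2)) - int (b (j+1))) * (int (a j) - int (a (j+1)))
         - (int (b (j+1)) - int (b j)) * (int (a (j+1)) - int (a (j+2)))"

lemma gap_form_bounds:
  assumes "j + 4 < L" "b (j+4) - b j \<le> K"
  shows "1 \<le> gap_form j" "gap_form j \<le> 3 * int K ^ 3"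
proof -
  have mono: "b j < b (j+1)" "b (j+1) < b (j+2)" "b (j+2) < b (j+3)" "b (j+3) < b (j+4)"
    using assms(1) by (auto intro: b_strict_mono)
  define k where "k = int (b (j+1)) - int (b j)"
  define k' where "k' = int (b (j+2)) - int (b (j+1))"
  define k'' where "k'' = int (b (j+3)) - int (b (j+2))"
  have k: "1 \<le> k" "k \<le> K" "1 \<le> k'" "k' \<le> K" "1 \<le> k''" "k'' \<le> K"
    using mono assms(2) by (auto simp: k_def k'_def k''_def)
  have Qe: "gap_form j = k\<^sup>2 * k' + (k - 1) * k'\<^sup>2 + k * k''"
    by (simp add: gap_form_def Let_def k_def k'_def k''_def)
  have "0 \<le> k\<^sup>2 * k'" "0 \<le> (k - 1) * k'\<^sup>2" "0 < k * k''"
    using k by auto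
  then show "1 \<le> gap_form j" unfolding Qe by simp
  have "k\<^sup>2 * k' \<le> int K ^ 2 * int K" using k by (intro mult_mono power_mono) auto
  moreover have "(k - 1) * k'\<^sup>2 \<le> int K * int K ^ 2" using k by (intro mult_mono power_mono) auto
  moreover have "k * k'' \<le> int K * int K" using k by (intro mult_mono) auto
  moreover have "int K * int K \<le> int K ^ 3"
    using k power_increasing[of 2 3 "int K"] by (simp add: power2_eq_square)
  moreover have "int K * int K ^ 2 = int K ^ 3" by (simp add: power2_eq_square power3_eq_cube)
  ultimately show "gap_form j \<le> 3 * int K ^ 3" unfolding Qe by (simp add: mult.commute)
qed

text \<open>
  This is \<open>curvature_estimate\<close> multiplied by \<open>q\<^sup>2\<close>. The lower bound on \<open>q = b\<^sub>j\<^sub>+\<^sub>1\<close> keeps \<open>b\<^sub>j\<close> above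
  \<open>q/2\<close>, so that \<open>a\<^sub>j\<close> too is at most \<open>2 n/q\<close>.
\<close>

lemma gap_det_approx:
  assumes j: "j + 4 < L" and K: "b (j+4) - b j \<le> K" and q: "42 * real K ^ 4 \<le> real (b (j+1))"
  shows "\<bar>real_of_int (gap_det j) * real (b (j+1)) ^ 3 / real n - real_of_int (gap_form j)\<bar>
         \<le> 21 * real K ^ 4 / real (b (j+1))"
proof -
  have mono: "b j < b (j+1)" "b (j+1) < b (j+2)" "b (j+2) < b (j+3)" "b (j+3) < b (j+4)"
    using j by (auto intro: b_strict_mono)
  have K1: "1 \<le> real K" using mono K by linarith
  then have K4: "real K \<le> real K ^ 4" by (intro self_le_power) auto
  define q where "q = real (b (j+1))"
  define t where "t = 1 / q"
  define y where "y i = real (a (j+i)) * q / real n" for i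
  have q0: "0 < q" using K1 K4 q unfolding q_def by linarith
  have t0: "0 < t" using q0 by (simp add: t_def)
  have n0: "0 < real n" using n_pos[of j] j by simp
  have step: "real n = real (a (j+i)) * real (b (j+i)) + real (a (j+Suc i))" if "i \<le> 4" for i
    using n_eq[of "j+i"] j that by (metis add_Suc_right add_le_cancel_left le_less_trans of_nat_add of_nat_mult)
  have rel: "y i * (real (b (j+i)) * t) + t * y (Suc i) = 1" if "i \<le> 4" for i
  proof -
    have "y i * (real (b (j+i)) * t) + t * y (Suc i)
        = (real (a (j+i)) * real (b (j+i)) + real (a (j+Suc i))) / real n"
      using q0 by (simp add: y_def t_def add_divide_distrib)
    then show ?thesis using step[OF that] n0 by simp
  qed
  define k where "k = real (b (j+1)) - real (b j)"
  define k' where "k' = real (b (j+2)) - real (b (j+1))"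
  define k'' where "k'' = real (b (j+3)) - real (b (j+2))"
  define k3 where "k3 = real (b (j+4)) - real (b (j+3))"
  have bb: "real (b j) * t = 1 - k * t" "real (b (j+1)) * t = 1"
    "real (b (j+2)) * t = 1 + k' * t" "real (b (j+3)) * t = 1 + (k' + k'') * t"
    "real (b (j+4)) * t = 1 + (k' + k'' + k3) * t"
    using q0 by (simp_all add: t_def q_def k_def k'_def k''_def k3_def field_simps)
  have y0: "0 \<le> y i" for i using q0 by (simp add: y_def)
  have y1: "y 1 \<le> 1"
  proof -
    have "0 \<le> t * y (Suc 1)" using t0 y0 by simp
    then show ?thesis using rel[of 1] bb(2) by simp
  qed
  have yle: "y i \<le> 1" if "1 \<le> i" "i \<le> 5" for i
  proof -
    have "a (j+i) \<le> a (j+1)" using a_antimono[of "j+1" "j+i"] that j by simp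
    then have "y i \<le> y 1" using q0 by (simp add: y_def divide_right_mono)
    then show ?thesis using y1 by linarith
  qed
  have kK: "k + k' + k'' + k3 \<le> K" "0 \<le> k" "0 \<le> k'" "0 \<le> k''" "0 \<le> k3"
    using mono K by (auto simp: k_def k'_def k''_def k3_def)
  have "2 * k \<le> q" using kK K4 K1 q unfolding q_def by linarith
  then have "k * t \<le> 1 / 2" using q0 by (simp add: t_def field_simps)
  then have "y 0 * (1 / 2) \<le> y 0 * (1 - k * t)" using y0[of 0] by (intro mult_left_mono) auto
  also have "\<dots> \<le> 1"
  proof -
    have "0 \<le> t * y 1" using t0 y0[of 1] by simp
    then show ?thesis using rel[of 0] bb(1) by simp
  qed
  finally have y02: "y 0 \<le> 2" by simp
  have "\<bar>k' * (y 0 - y 1) - k * (y 1 - y 2) - (k\<^sup>2 * k' + (k - 1) * k'\<^sup>2 + k * k'') * t\<^sup>2\<bar>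
      \<le> 21 * real K ^ 4 * t ^ 3"
  proof (rule curvature_estimate[OF t0 K1, of _ _ _ k3 _ _ _ "y 3" "y 4" "y 5"])
    show "y 0 * (1 - k * t) + t * y 1 = 1" using rel[of 0] bb by simp
    show "y 1 + t * y 2 = 1" using rel[of 1] bb by (simp add: numeral_2_eq_2)
    show "y 2 * (1 + k' * t) + t * y 3 = 1" using rel[of 2] bb by (simp add: numeral_3_eq_3)
    show "y 3 * (1 + (k' + k'') * t) + t * y 4 = 1" using rel[of 3] bb by simp
    show "y 4 * (1 + (k' + k'' + k3) * t) + t * y 5 = 1" using rel[of 4] bb by simp
  qed (use kK y0 yle y02 in \<open>auto simp: abs_of_nonneg\<close>)
  also have "k\<^sup>2 * k' + (k - 1) * k'\<^sup>2 + k * k'' = real_of_int (gap_form j)"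
    by (simp add: gap_form_def Let_def k_def k'_def k''_def)
  also have "k' * (y 0 - y 1) - k * (y 1 - y 2) = real_of_int (gap_det j) * q / real n"
    using n0 by (simp add: gap_det_def k_def k'_def y_def field_simps)
  finally have "\<bar>real_of_int (gap_det j) * q / real n - real_of_int (gap_form j) * t\<^sup>2\<bar> * q\<^sup>2
      \<le> 21 * real K ^ 4 * t ^ 3 * q\<^sup>2" by (intro mult_right_mono) auto
  also have "\<bar>real_of_int (gap_det j) * q / real n - real_of_int (gap_form j) * t\<^sup>2\<bar> * q\<^sup>2
      = \<bar>(real_of_int (gap_det j) * q / real n - real_of_int (gap_form j) * t\<^sup>2) * q\<^sup>2\<bar>"
    by (simp add: abs_mult)
  also have "(real_of_int (gap_det j) * q / real n - real_of_int (gap_form j) * t\<^sup>2) * q\<^sup>2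
      = real_of_int (gap_det j) * q ^ 3 / real n - real_of_int (gap_form j)"
    using q0 by (simp add: t_def field_simps power2_eq_square power3_eq_cube)
  also have "21 * real K ^ 4 * t ^ 3 * q\<^sup>2 = 21 * real K ^ 4 / q"
    using q0 by (simp add: t_def field_simps power2_eq_square power3_eq_cube)
  finally show ?thesis by (simp add: q_def)
qed

text \<open>
  A pair of values of \<open>gap_form\<close> and \<open>gap_det\<close> nearly determines \<open>q = b\<^sub>j\<^sub>+\<^sub>1\<close>, because \<open>M q\<^sup>3/n\<close> lies within
  \<open>E/q\<close> of \<open>Q\<close>, where \<open>E = 21 K\<^sup>4\<close>, and grows with slope about \<open>3 Q/q\<close> in \<open>q\<close>. The hypothesis on \<open>X\<close>
  makes \<open>E/q \<le> 1/2\<close>; as \<open>Q \<ge> 1\<close>, this forces \<open>M\<close> to be positive, of size comparable to \<open>Q n/q\<^sup>3\<close>.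
\<close>

lemma card_short_window:
  fixes X :: real
  assumes X: "0 < X" "42 * real K ^ 4 \<le> X"
  defines "S \<equiv> {j. j + 4 < L \<and> X \<le> real (b j) \<and> b (j+4) - b j \<le> K}"
  shows "real (card S) \<le> 392 * real K ^ 10 * real n / X ^ 3"
proof (cases "S = {}")
  case True
  then show ?thesis using X by simp
next
  case False
  have bj: "b j < b (j+1)" "b j < b (j+4)" if "j \<in> S" for j
    using that by (auto simp: S_def intro: b_strict_mono)
  have K1: "1 \<le> K" using False bj by (fastforce simp: S_def)
  define m where "m = nat \<lfloor>9 / 2 * real K ^ 3 * real n / X ^ 3\<rfloor>"
  define R where "R = {1..3 * int K ^ 3} \<times> {1..int m}"
  have approx: "\<bar>real_of_int (gap_det j) * real (b (j+1)) ^ 3 / real n - real_of_int (gap_form j)\<bar>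
         \<le> 21 * real K ^ 4 / real (b (j+1))" and qX: "X \<le> real (b (j+1))"
    and Q: "1 \<le> gap_form j" "gap_form j \<le> 3 * int K ^ 3" and n0: "0 < real n" if "j \<in> S" for j
  proof -
    have j: "j + 4 < L" "b (j+4) - b j \<le> K" using that by (auto simp: S_def)
    show qX: "X \<le> real (b (j+1))" using that bj[OF that] by (auto simp: S_def)
    show "1 \<le> gap_form j" "gap_form j \<le> 3 * int K ^ 3" using gap_form_bounds[OF j] by auto
    show "\<bar>real_of_int (gap_det j) * real (b (j+1)) ^ 3 / real n - real_of_int (gap_form j)\<bar>
         \<le> 21 * real K ^ 4 / real (b (j+1))"
      using gap_det_approx[OF j] qX X by linarith
    show "0 < real n" using n_pos[of j] j by simp
  qed
  have half: "21 * real K ^ 4 / real (b (j+1)) \<le> 1 / 2" if "j \<in> S" for j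
    using qX[OF that] X by (simp add: field_simps)
  have inR: "(gap_form j, gap_det j) \<in> R" if "j \<in> S" for j
  proof -
    define q where "q = real (b (j+1))"
    have q0: "0 < q" and Xq: "X \<le> q" using qX[OF that] X by (auto simp: q_def)
    have Q1: "1 \<le> real_of_int (gap_form j)" using Q(1)[OF that] by simp
    have ap: "\<bar>real_of_int (gap_det j) * q ^ 3 / real n - real_of_int (gap_form j)\<bar> \<le> 1 / 2"
      using approx[OF that] half[OF that] unfolding q_def by linarith
    then have "0 < real_of_int (gap_det j) * q ^ 3 / real n" using Q1 by linarith
    then have M0: "0 < gap_det j" using q0 n0[OF that] by (simp add: zero_less_divide_iff zero_less_mult_iff)
    have "real_of_int (gap_det j) * q ^ 3 / real n \<le> 3 / 2 * real_of_int (gap_form j)" using ap Q1 by linarith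
    also have "\<dots> \<le> 3 / 2 * (3 * real K ^ 3)"
    proof -
      have "real_of_int (gap_form j) \<le> real_of_int (3 * int K ^ 3)"
        using Q(2)[OF that] by (simp only: of_int_le_iff)
      then show ?thesis by simp
    qed
    finally have "real_of_int (gap_det j) * q ^ 3 \<le> 9 / 2 * real K ^ 3 * real n"
      using n0[OF that] by (simp add: field_simps)
    moreover have "real_of_int (gap_det j) * X ^ 3 \<le> real_of_int (gap_det j) * q ^ 3"
      using Xq X M0 by (intro mult_left_mono power_mono) auto
    ultimately have "real_of_int (gap_det j) \<le> 9 / 2 * real K ^ 3 * real n / X ^ 3"
      using X by (simp add: field_simps)
    then have "gap_det j \<le> int m" unfolding m_def by linarith
    then show ?thesis using M0 Q[OF that] by (simp add: R_def)
  qed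
  have fibre: "card {j \<in> S. (gap_form j, gap_det j) = r} \<le> 28 * K ^ 4 + 1" (is "card ?F \<le> _") for r
  proof -
    have "inj_on (\<lambda>j. b (j+1)) ?F"
    proof (rule inj_onI)
      fix i j assume "i \<in> ?F" "j \<in> ?F" "b (i+1) = b (j+1)"
      then show "i = j" using inj_onD[OF b_inj, of "i+1" "j+1"] by (auto simp: S_def)
    qed
    then have "card ?F = card ((\<lambda>j. b (j+1)) ` ?F)" by (simp add: card_image)
    \<comment> \<open>The bound \<open>28 K\<^sup>4\<close> on the diameter is \<open>4 E/3\<close>: two values \<open>p \<le> q\<close> satisfy \<open>M (q\<^sup>3 - p\<^sup>3)/n \<le> 2 E/p\<close>,
      while \<open>M p\<^sup>3/n \<ge> 1/2\<close>.\<close>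
    also have "\<dots> \<le> 28 * K ^ 4 + 1"
    proof (rule card_le_of_diameter)
      fix x x' assume "x \<in> (\<lambda>j. b (j+1)) ` ?F" "x' \<in> (\<lambda>j. b (j+1)) ` ?F" and xx': "x \<le> x'"
      then obtain i j where ij: "i \<in> S" "j \<in> S" "gap_form i = gap_form j" "gap_det i = gap_det j"
        "x = b (i+1)" "x' = b (j+1)"
        by auto
      define E where "E = 21 * real K ^ 4"
      define p where "p = real x"
      define q where "q = real x'"
      define u where "u = real_of_int (gap_det j) / real n"
      have p0: "0 < p" using qX[OF ij(1)] X ij by (simp add: p_def)
      have pq: "p \<le> q" using xx' by (simp add: p_def q_def)
      have E0: "0 \<le> E" by (simp add: E_def)
      have ai: "\<bar>u * p ^ 3 - real_of_int (gap_form j)\<bar> \<le> E / p" and hi: "E / p \<le> 1 / 2"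
        using approx[OF ij(1)] half[OF ij(1)] ij by (simp_all add: u_def p_def E_def)
      have aj: "\<bar>u * q ^ 3 - real_of_int (gap_form j)\<bar> \<le> E / q"
        using approx[OF ij(2)] ij by (simp add: u_def q_def E_def)
      have "E / q \<le> E / p" using pq p0 E0 by (intro divide_left_mono) auto
      then have d: "u * (q ^ 3 - p ^ 3) \<le> 2 * (E / p)"
        using ai aj unfolding right_diff_distrib by linarith
      have "1 / 2 \<le> u * p ^ 3" using ai hi Q(1)[OF ij(2)] by linarith
      then have u: "1 / (2 * p ^ 3) \<le> u" using p0 by (simp add: field_simps)
      have "3 * p\<^sup>2 * (q - p) \<le> q ^ 3 - p ^ 3"
      proof -
        have "q ^ 3 - p ^ 3 - 3 * p\<^sup>2 * (q - p) = (q - p)\<^sup>2 * (q + 2 * p)"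
          by (simp add: power2_eq_square power3_eq_cube algebra_simps)
        moreover have "0 \<le> (q - p)\<^sup>2 * (q + 2 * p)" using p0 pq by simp
        ultimately show ?thesis by linarith
      qed
      then have "1 / (2 * p ^ 3) * (3 * p\<^sup>2 * (q - p)) \<le> u * (q ^ 3 - p ^ 3)"
        using u p0 pq by (intro mult_mono) (auto intro: order_trans[rotated])
      also note d
      finally have "3 * (q - p) / (2 * p) \<le> 4 * E / (2 * p)"
        using p0 by (simp add: power2_eq_square power3_eq_cube)
      then have "3 * (q - p) \<le> 4 * E"
        using p0 divide_le_cancel[of "3 * (q - p)" "2 * p" "4 * E"] by linarith
      then have "real x' \<le> real (x + 28 * K ^ 4)" by (simp add: p_def q_def E_def)
      then show "x' \<le> x + 28 * K ^ 4" by (simp only: of_nat_le_iff)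
    qed
    finally show ?thesis .
  qed
  have "card S \<le> card R * (28 * K ^ 4 + 1)"
    by (rule card_le_of_fibres[OF _ inR fibre]) (simp_all add: R_def)
  also have "card R = 3 * K ^ 3 * m"
    by (simp add: R_def card_cartesian_product nat_mult_distrib nat_power_eq)
  finally have "real (card S) \<le> real (3 * K ^ 3 * m * (28 * K ^ 4 + 1))" by (simp only: of_nat_le_iff)
  also have "\<dots> = 3 * real K ^ 3 * real m * (28 * real K ^ 4 + 1)"
    by (simp add: algebra_simps)
  also have "\<dots> \<le> 3 * real K ^ 3 * (9 / 2 * real K ^ 3 * real n / X ^ 3) * (29 * real K ^ 4)"
  proof -
    have "real m \<le> 9 / 2 * real K ^ 3 * real n / X ^ 3"
      using X unfolding m_def by simp
    moreover have "1 \<le> real K ^ 4" using K1 by simp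
    ultimately show ?thesis using X by (intro mult_mono) auto
  qed
  also have "\<dots> = 391.5 * (real K ^ 10 * real n / X ^ 3)"
    by (simp add: power_add[symmetric] mult_ac)
  also have "\<dots> \<le> 392 * real K ^ 10 * real n / X ^ 3"
  proof -
    have "0 \<le> real K ^ 10 * real n / X ^ 3" using X by simp
    then show ?thesis by (simp add: mult.assoc)
  qed
  finally show ?thesis .
qed

text \<open>
  Two such indices in the same residue class modulo \<open>4\<close> differ by at least \<open>4\<close>, so their values
  of \<open>b\<close> are more than \<open>K\<close> apart.
\<close>

lemma card_long_window:
  assumes K: "0 < K"
  shows "card {j. j + 4 < L \<and> b j \<le> Y \<and> K < b (j+4) - b j} \<le> 4 * (Y div K + 1)"
    (is "card ?B \<le> _")
proof -
  have "inj_on (\<lambda>j. (j mod 4, b j div K)) ?B"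
  proof (rule linorder_inj_onI')
    fix i j assume ij: "i \<in> ?B" "j \<in> ?B" "i < j"
    show "(i mod 4, b i div K) \<noteq> (j mod 4, b j div K)"
    proof
      assume eq: "(i mod 4, b i div K) = (j mod 4, b j div K)"
      then have "i mod 4 = j mod 4" by simp
      with ij(3) have "i + 4 \<le> j" by presburger
      then have "b (i+4) \<le> b j"
        using ij b_strict_mono[of "i+4" j] by (cases "i + 4 = j") auto
      then have "b i + K \<le> b j" using ij by auto
      then have "(b i + K) div K \<le> b j div K" by (rule div_le_mono)
      then show False using K eq by simp
    qed
  qed
  moreover have "(\<lambda>j. (j mod 4, b j div K)) ` ?B \<subseteq> {..<4} \<times> {..Y div K}"
    by (auto intro: div_le_mono)
  ultimately have "card ?B \<le> card ({..<4::nat} \<times> {..Y div K})"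
    by (intro card_inj_on_le) auto
  then show ?thesis by (simp add: card_cartesian_product)
qed

lemma card_quotient_range:
  fixes X :: real
  assumes X: "0 < X" "42 * real K ^ 4 \<le> X" and K: "0 < K" and Y: "0 \<le> Y"
  shows "real (card {j. j < L \<and> X \<le> real (b j) \<and> real (b j) \<le> Y})
         \<le> 8 + 4 * (Y / real K) + 392 * real K ^ 10 * real n / X ^ 3"
    (is "real (card ?T) \<le> _")
proof -
  define S where "S = {j. j + 4 < L \<and> X \<le> real (b j) \<and> b (j+4) - b j \<le> K}"
  define B where "B = {j. j + 4 < L \<and> b j \<le> nat \<lfloor>Y\<rfloor> \<and> K < b (j+4) - b j}"
  \<comment> \<open>The last four indices are set aside: \<open>b (j+4)\<close> has no meaning for them.\<close>
  have "?T \<subseteq> {L-4..<L} \<union> (B \<union> S)"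
    using Y by (auto simp: B_def S_def le_nat_floor)
  then have "card ?T \<le> card ({L-4..<L} \<union> (B \<union> S))"
    by (intro card_mono finite_subset[of "{L-4..<L} \<union> (B \<union> S)" "{..<L}"]) (auto simp: B_def S_def)
  also have "\<dots> \<le> card {L-4..<L} + (card B + card S)"
    by (meson add_left_mono card_Un_le order_trans)
  finally have "real (card ?T) \<le> real (card {L-4..<L}) + real (card B) + real (card S)" by linarith
  moreover have "real (card {L-4..<L}) \<le> 4" by simp
  moreover have "real (card B) \<le> 4 * (Y / real K) + 4"
  proof -
    have "card B \<le> 4 * (nat \<lfloor>Y\<rfloor> div K + 1)"
      unfolding B_def by (rule card_long_window[OF K])
    then have "real (card B) \<le> real (4 * (nat \<lfloor>Y\<rfloor> div K + 1))" by (simp only: of_nat_le_iff)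
    also have "\<dots> = 4 * (real (nat \<lfloor>Y\<rfloor> div K) + 1)"
      by (simp only: of_nat_mult of_nat_add of_nat_1 of_nat_numeral)
    also have "real (nat \<lfloor>Y\<rfloor> div K) \<le> real (nat \<lfloor>Y\<rfloor>) / real K" by (rule of_nat_div_le_of_nat)
    also have "\<dots> \<le> Y / real K" using Y by (intro divide_right_mono) auto
    finally show ?thesis by simp
  qed
  moreover have "real (card S) \<le> 392 * real K ^ 10 * real n / X ^ 3"
    unfolding S_def by (rule card_short_window[OF X])
  ultimately show ?thesis by linarith
qed

subsection \<open>Small terms\<close>

text \<open>
  The index \<open>j\<close> is determined by \<open>a\<^sub>j\<close>, which divides \<open>n + d\<close> for \<open>d = a\<^sub>j - a\<^sub>j\<^sub>+\<^sub>1\<close>; this serves the gaps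
  up to \<open>D\<close>. Terms followed by a larger gap are more than \<open>D\<close> apart.
\<close>

lemma card_small_terms:
  assumes D: "0 < D"
  shows "card {j. j < L \<and> a j \<le> A}
         \<le> (\<Sum>d\<in>{1..D}. card {e. e dvd n + d}) + (A div D + 1)"
    (is "card ?U \<le> _")
proof -
  define U1 where "U1 = {j \<in> ?U. a j - a (Suc j) \<le> D}"
  define U2 where "U2 = {j \<in> ?U. D < a j - a (Suc j)}"
  have "inj_on (\<lambda>j. (a j - a (Suc j), a j)) U1"
    by (rule linorder_inj_onI') (use a_strict_antimono in \<open>fastforce simp: U1_def\<close>)
  moreover have "(\<lambda>j. (a j - a (Suc j), a j)) ` U1 \<subseteq> Sigma {1..D} (\<lambda>d. {e. e dvd n + d})"
  proof (rule image_subsetI)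
    fix j assume "j \<in> U1"
    then have j: "j < L" "a j - a (Suc j) \<le> D" by (auto simp: U1_def)
    have less: "a (Suc j) < a j" using a_decreasing[OF j(1)] .
    then have "n + (a j - a (Suc j)) = a j * (b j + 1)" using n_eq[OF j(1)] by simp
    then have "a j dvd n + (a j - a (Suc j))" by (metis dvd_triv_left)
    then show "(a j - a (Suc j), a j) \<in> Sigma {1..D} (\<lambda>d. {e. e dvd n + d})"
      using j less by auto
  qed
  ultimately have "card U1 \<le> card (Sigma {1..D} (\<lambda>d. {e. e dvd n + d}))"
    by (rule card_inj_on_le) (auto intro!: finite_divisors_nat)
  also have "\<dots> = (\<Sum>d\<in>{1..D}. card {e. e dvd n + d})"
    by (subst card_SigmaI) (auto intro!: finite_divisors_nat)
  finally have 1: "card U1 \<le> (\<Sum>d\<in>{1..D}. card {e. e dvd n + d})" .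
  have "inj_on (\<lambda>j. a j div D) U2"
  proof (rule linorder_inj_onI')
    fix i j assume ij: "i \<in> U2" "j \<in> U2" "i < j"
    have "a j \<le> a (Suc i)" using ij a_antimono[of "Suc i" j] by (auto simp: U2_def)
    then have "a j + D \<le> a i" using ij by (auto simp: U2_def)
    then have "(a j + D) div D \<le> a i div D" by (rule div_le_mono)
    then show "a i div D \<noteq> a j div D" using D by simp
  qed
  moreover have "(\<lambda>j. a j div D) ` U2 \<subseteq> {..A div D}" by (auto simp: U2_def intro: div_le_mono)
  ultimately have "card U2 \<le> card {..A div D}" by (rule card_inj_on_le) auto
  then have 2: "card U2 \<le> A div D + 1" by simp
  have "?U = U1 \<union> U2" by (auto simp: U1_def U2_def)
  then have "card ?U \<le> card U1 + card U2" using card_Un_le by metis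
  then show ?thesis using 1 2 by linarith
qed

end

section \<open>The bound on the length\<close>

lemma pierce_seq_pos:
  assumes "0 < a" "j < pierce_length a n"
  shows "0 < pierce_seq a n j"
  using not_less_Least[of j "\<lambda>k. 0 < k \<and> pierce_seq a n k = 0"] assms
  unfolding pierce_length_def by (cases "j = 0") auto

lemma pierce_expansion_pierce_seq:
  assumes "0 < a"
  shows "pierce_expansion n (pierce_length a n) (pierce_seq a n) (\<lambda>j. n div pierce_seq a n j)"
  using pierce_seq_pos[OF assms] by unfold_locales (auto simp: mult.commute)

lemma pierce_length_le:
  assumes "0 < a"
  shows "pierce_length a n \<le> a"
proof -
  interpret pierce_expansion n "pierce_length a n" "pierce_seq a n" "\<lambda>j. n div pierce_seq a n j"
    by (rule pierce_expansion_pierce_seq[OF assms])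
  have "pierce_seq a n k + k \<le> a" if "k \<le> pierce_length a n" for k
    using that
  proof (induction k)
    case (Suc k)
    then show ?case using a_decreasing[of k] by simp
  qed simp
  from this[of "pierce_length a n"] show ?thesis by simp
qed

text \<open>
  Here \<open>T\<close> stands for the divisor bound. The condition \<open>z \<ge> 10\<close> gives \<open>672 \<le> z\<^sup>3\<close>, as the hypothesis
  \<open>42 K\<^sup>4 \<le> X\<close> of the window counts requires for \<open>K \<le> 2 z\<^sup>i\<close>.
\<close>

lemma pierce_length_bound:
  fixes z T :: real
  assumes z: "10 \<le> z" "z ^ 59 = real n" and a: "0 < a"
    and div: "\<And>m. 0 < m \<Longrightarrow> m \<le> 3 * n \<Longrightarrow> real (card {d. d dvd m}) \<le> T"
  shows "real (pierce_length a n) \<le> (804004 + 2 * T) * z ^ 19"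
proof -
  define L where "L = pierce_length a n"
  define q where "q j = n div pierce_seq a n j" for j
  interpret pierce_expansion n L "pierce_seq a n" q
    unfolding L_def q_def by (rule pierce_expansion_pierce_seq[OF a])
  have z0: "0 < z" using z by simp
  have n0: "0 < n" using z by (metis of_nat_0_less_iff z0 zero_less_power)
  have z1: "1 \<le> z ^ i" for i using z by simp
  have mono: "z ^ i \<le> z ^ j" if "i \<le> j" for i j using z that by (intro power_increasing) auto
  define W where "W = {j. j < L \<and> real (q j) \<le> z ^ 19}"
  define T1 where "T1 = {j. j < L \<and> z ^ 19 \<le> real (q j) \<and> real (q j) \<le> z ^ 20}"
  define T2 where "T2 = {j. j < L \<and> z ^ 20 \<le> real (q j) \<and> real (q j) \<le> z ^ 21}"
  define U where "U = {j. j < L \<and> pierce_seq a n j \<le> nat \<lfloor>z ^ 38\<rfloor>}"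
  have "{..<L} \<subseteq> W \<union> (T1 \<union> (T2 \<union> U))"
  proof
    fix j assume "j \<in> {..<L}"
    then have j: "j < L" by simp
    have "pierce_seq a n j \<le> nat \<lfloor>z ^ 38\<rfloor>" if "z ^ 21 < real (q j)"
    proof -
      have "real (pierce_seq a n j) * z ^ 21 \<le> real (pierce_seq a n j) * real (q j)"
        using that by (intro mult_left_mono) auto
      also have "\<dots> \<le> real n" using n_eq[OF j] by (metis le_add1 of_nat_le_iff of_nat_mult)
      also have "\<dots> = z ^ 38 * z ^ 21" by (simp add: z(2)[symmetric] power_add[symmetric])
      finally have "real (pierce_seq a n j) \<le> z ^ 38" using z0 by (simp only: mult_le_cancel_right) simp
      then show ?thesis by (rule le_nat_floor)
    qed
    then show "j \<in> W \<union> (T1 \<union> (T2 \<union> U))"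
      using j unfolding W_def T1_def T2_def U_def by (cases "z ^ 21 < real (q j)") auto
  qed
  then have "card {..<L} \<le> card (W \<union> (T1 \<union> (T2 \<union> U)))"
    by (intro card_mono finite_subset[of "W \<union> (T1 \<union> (T2 \<union> U))" "{..<L}"])
      (auto simp: W_def T1_def T2_def U_def)
  also have "\<dots> \<le> card W + (card T1 + (card T2 + card U))"
    by (meson add_left_mono card_Un_le order_trans)
  finally have L: "real L \<le> real (card W) + real (card T1) + real (card T2) + real (card U)" by simp
  have W: "real (card W) \<le> z ^ 19 + 1"
  proof -
    have "inj_on q W" using b_inj by (rule inj_on_subset) (auto simp: W_def)
    moreover have "q ` W \<subseteq> {..nat \<lfloor>z ^ 19\<rfloor>}" by (auto simp: W_def le_nat_floor)
    ultimately have "card W \<le> card {..nat \<lfloor>z ^ 19\<rfloor>}" by (rule card_inj_on_le) simp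
    then show ?thesis using z1[of 19] by simp linarith
  qed
  have ceil: "z ^ i \<le> real (nat \<lceil>z ^ i\<rceil>)" "real (nat \<lceil>z ^ i\<rceil>) \<le> 2 * z ^ i" "0 < nat \<lceil>z ^ i\<rceil>" for i
    using z1[of i] by linarith+
  \<comment> \<open>The window from \<open>z\<^sup>x\<close> to \<open>z\<close> to the power \<open>19 + i\<close> with gap bound about \<open>z\<^sup>i\<close>: the side conditions
    say that the gap bound is admissible and that \<open>K\<^sup>1\<^sup>0 n/X\<^sup>3\<close> is \<open>O(z\<^sup>1\<^sup>9)\<close>.\<close>
  have window: "real (card {j. j < L \<and> z ^ x \<le> real (q j) \<and> real (q j) \<le> z ^ (19 + i)}) \<le> 402000 * z ^ 19"
    if "4 * i + 3 \<le> x" "40 + 10 * i \<le> 3 * x" for x i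
  proof -
    define K where "K = nat \<lceil>z ^ i\<rceil>"
    have K10: "real K ^ m \<le> 2 ^ m * z ^ (i * m)" for m
      using power_mono[of "real K" "2 * z ^ i" m] ceil(2)[of i]
      by (simp add: K_def power_mult power_mult_distrib)
    have "42 * real K ^ 4 \<le> 672 * z ^ (i * 4)" using K10[of 4] by simp
    also have "\<dots> \<le> z ^ 3 * z ^ (i * 4)"
      using power_mono[of 10 z 3] z by (intro mult_right_mono) auto
    also have "\<dots> \<le> z ^ x" using mono[of "i * 4 + 3" x] that by (simp add: power_add mult.commute)
    finally have "real (card {j. j < L \<and> z ^ x \<le> real (q j) \<and> real (q j) \<le> z ^ (19 + i)})
        \<le> 8 + 4 * (z ^ (19 + i) / real K) + 392 * real K ^ 10 * real n / (z ^ x) ^ 3"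
      using z0 ceil(3)[of i] by (intro card_quotient_range) (auto simp: K_def)
    moreover have "z ^ (19 + i) / real K \<le> z ^ 19"
      using ceil(1,3)[of i] z0 by (simp add: K_def field_simps power_add)
    moreover have "392 * real K ^ 10 * real n / (z ^ x) ^ 3 \<le> 401408 * z ^ 19"
    proof -
      have "392 * real K ^ 10 * real n \<le> 392 * (1024 * z ^ (i * 10)) * z ^ 59"
        using K10[of 10] z(2) z0 by (intro mult_mono) auto
      also have "\<dots> = 401408 * z ^ (40 + 10 * i) * z ^ 19"
        by (simp add: mult_ac add_ac flip: power_add)
      also have "\<dots> \<le> 401408 * z ^ (3 * x) * z ^ 19"
        using mono[OF that(2)] z0 by simp
      finally show ?thesis using z0 by (simp add: field_simps flip: power_mult)
    qed
    ultimately show ?thesis using z1[of 19] by linarith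
  qed
  have T1: "real (card T1) \<le> 402000 * z ^ 19"
    using window[of 1 19] by (simp add: T1_def)
  have T2: "real (card T2) \<le> 402000 * z ^ 19"
    using window[of 2 20] by (simp add: T2_def)
  have U: "real (card U) \<le> 2 * T * z ^ 19 + z ^ 19 + 1"
  proof -
    define D where "D = nat \<lceil>z ^ 19\<rceil>"
    have D0: "0 < D" and Dz: "z ^ 19 \<le> real D" "real D \<le> 2 * z ^ 19"
      using ceil[of 19] by (auto simp: D_def)
    have "2 * z ^ 19 \<le> 2 * real n" using mono[of 19 59] z by simp
    then have "D \<le> 2 * n" using Dz by linarith
    have "T \<ge> 0" using div[of 1] n0 by simp
    have "(\<Sum>d\<in>{1..D}. real (card {e. e dvd n + d})) \<le> real (card {1..D}) * T"
      using \<open>D \<le> 2 * n\<close> n0 by (intro sum_bounded_above div) auto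
    also have "\<dots> \<le> 2 * z ^ 19 * T" using Dz \<open>T \<ge> 0\<close> by (simp add: mult_right_mono)
    finally have s: "(\<Sum>d\<in>{1..D}. real (card {e. e dvd n + d})) \<le> 2 * z ^ 19 * T" .
    have "real (nat \<lfloor>z ^ 38\<rfloor> div D) \<le> real (nat \<lfloor>z ^ 38\<rfloor>) / real D" by (rule of_nat_div_le_of_nat)
    also have "\<dots> \<le> z ^ 38 / z ^ 19" using Dz z0 z1[of 38] by (intro frac_le) auto
    also have "\<dots> = z ^ 19" using z0 by (simp add: field_simps flip: power_add)
    finally have d: "real (nat \<lfloor>z ^ 38\<rfloor> div D) \<le> z ^ 19" .
    have "real (card U) \<le> real ((\<Sum>d\<in>{1..D}. card {e. e dvd n + d}) + (nat \<lfloor>z ^ 38\<rfloor> div D + 1))"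
      unfolding U_def of_nat_le_iff by (rule card_small_terms[OF D0])
    then show ?thesis using s d by (simp add: mult_ac)
  qed
  show ?thesis
    using L W T1 T2 U z1[of 19] unfolding L_def[symmetric] by (simp add: algebra_simps)
qed

theorem theorem1p1:
  fixes \<epsilon> :: real
  assumes "\<epsilon> > 0"
  shows "\<exists>C::real. C > 0 \<and>
    (\<forall>n::nat. n > 0 \<longrightarrow> real (pierce_max n) \<le> C * real n powr (1/3 - 2/177 + \<epsilon>))"
proof -
  obtain C where C: "0 < C"
    and div: "\<And>m::nat. 0 < m \<Longrightarrow> real (card {d. d dvd m}) \<le> C * real m powr \<epsilon>"
    using divisor_bound[OF assms] by blast
  \<comment> \<open>The summand \<open>10 ^ 59\<close> covers the small \<open>n\<close>, those with \<open>n\<close> to the power \<open>1/59\<close> below \<open>10\<close>.\<close>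
  define B where "B = 10 ^ 59 + 804004 + 2 * C * 3 powr \<epsilon>"
  have B0: "0 < B" using C by (simp add: B_def add_pos_nonneg)
  have "real (pierce_max n) \<le> B * real n powr (1/3 - 2/177 + \<epsilon>)" if n: "0 < n" for n :: nat
  proof -
    define z where "z = real n powr (1/59)"
    have zn: "z ^ 59 = real n"
      using n by (simp add: z_def powr_realpow[symmetric] powr_powr)
    have z19: "z ^ 19 = real n powr (1/3 - 2/177)"
      using n by (simp add: z_def powr_realpow[symmetric] powr_powr)
    have z1: "1 \<le> z" using n by (simp add: z_def ge_one_powr_ge_zero)
    have n\<epsilon>: "1 \<le> real n powr \<epsilon>" using n assms by (simp add: ge_one_powr_ge_zero)
    have "real (pierce_length a n) \<le> B * z ^ 19 * real n powr \<epsilon>" if a: "a \<in> {1..n}" for a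
    proof (cases "10 \<le> z")
      case True
      have "real (card {d. d dvd m}) \<le> C * 3 powr \<epsilon> * real n powr \<epsilon>" if "0 < m" "m \<le> 3 * n" for m
      proof -
        have "real m powr \<epsilon> \<le> (3 * real n) powr \<epsilon>"
          using that assms by (intro powr_mono2) auto
        then show ?thesis
          using order_trans[OF div[OF that(1)] mult_left_mono[of _ _ C]] C
          by (simp add: powr_mult mult.assoc)
      qed
      then have "real (pierce_length a n)
          \<le> (804004 + 2 * (C * 3 powr \<epsilon> * real n powr \<epsilon>)) * z ^ 19"
        using a by (intro pierce_length_bound[OF True zn]) auto
      also have "804004 + 2 * (C * 3 powr \<epsilon> * real n powr \<epsilon>) \<le> B * real n powr \<epsilon>"
        using n\<epsilon> by (simp add: B_def algebra_simps)
      finally show ?thesis using z1 by (simp add: mult_ac mult_right_mono)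
    next
      case False
      have "real (pierce_length a n) \<le> real n" using pierce_length_le[of a n] a by simp
      also have "\<dots> \<le> 10 ^ 59" using False z1 zn power_mono[of z 10 59] by simp
      also have "\<dots> \<le> B" using C by (simp add: B_def)
      also have "B \<le> B * (z ^ 19 * real n powr \<epsilon>)"
        using B0 z1 n\<epsilon> mult_mono[of 1 "z ^ 19" 1 "real n powr \<epsilon>"] by simp
      finally show ?thesis by (simp add: mult_ac)
    qed
    moreover have "pierce_max n \<in> (\<lambda>a. pierce_length a n) ` {1..n}"
      unfolding pierce_max_def using n by (intro Max_in) auto
    ultimately show ?thesis
      by (auto simp: z19 powr_add mult_ac)
  qed
  then show ?thesis using B0 by blast
qed

end
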